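(* Let $F$ and $B$ be graphs that are $k_F$-connected and $k_B$-connected, respectively, and let $G$ be a Cartesian graph bundle with fibre $F$ over the base graph $B$. Let $a,b$ be integers with $0<a<k_F$ and $0<b<k_B$. If $\mathcal{D}_{(a-1,1)}(F)\leq \mathcal{D}^{V}_{a}(F)$ and $\mathcal{D}_{(b-1,1)}(B)\leq \mathcal{D}^{V}_{b}(B)$, then $$\mathcal{D}^V_{a+b+1}(G)\leq \mathcal{D}^V_{a}(F)+\mathcal{D}^V_{b}(B).$$
   Context: All graphs are simple (undirected, no loops or multiple edges). $d_G(x,y)$ is the length of a shortest path between $x$ and $y$ in $G$ ($\infty$ if there is none), and the diameter $\mathcal{D}(G)$ of a connected graph $G$ is the maximum distance between two of its vertices. By convention $K_1$ is disconnected. Connectivity: for a connected non-complete graph $G$, $\kappa(G)$ is the smallest number of vertices whose removal disconnects $G$; $\kappa(K_n)=n-1$. $G$ is $k$-connected if $0<k\leq\kappa(G)$. A connected graph $G$ is $(p,q)$+connected if it remains connected after removal of any $p$ vertices and any $q$ edges. (A $(p+1)$-connected graph with $p>0$ is $(p-1,1)$+connected, so the quantities below are defined in the claim.) Deletion: for $X\subseteq V(G)\cup E(G)$ with $X_V = X\cap V(G)$, $X_E=X\cap E(G)$, the graph $G\setminus X$ is the subgraph of $(V(G),E(G)\setminus X_E)$ induced on $V(G)\setminus X_V$. Fault diameters: for a $k$-connected graph $G$ and $0\leq a<k$, the $a$-(vertex) fault diameter is $$\mathcal{D}^V_a(G)=\max\{\mathcal{D}(G\setminus X) \mid X\subseteq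 V(G), |X|=a\},$$ with $\mathcal{D}^V_a(G)=\infty$ if $a\geq\kappa(G)$. For a $(p,q)$+connected graph $G$, the $(p,q)$-mixed fault diameter is $$\mathcal{D}_{(p,q)}(G)=\max\{\mathcal{D}(G\setminus(X\cup Y)) \mid X\subseteq V(G), Y\subseteq E(G), |X|=p, |Y|=q\}$$ (edges of $Y$ are allowed to have endpoints in $X$). Cartesian product: $G_1\Box G_2$ has vertex set $V(G_1)\times V(G_2)$, and $(u_1,v_1)$, $(u_2,v_2)$ are adjacent if either $u_1u_2\in E(G_1)$ and $v_1=v_2$, or $v_1v_2\in E(G_2)$ and $u_1=u_2$. Cartesian graph bundle: a graph $G$ is a Cartesian graph bundle with fibre $F$ over the base graph $B$ if there is a graph map $p:G\to B$, i.e. a map $p:V(G)\cup E(G)\to V(B)\cup E(B)$ sending vertices to vertices and edges to vertices or edges (compatibly with incidence), such that for each vertex $v\in V(B)$ the subgraph $p^{-1}(\{v\})$ (the fibre over $v$) is isomorphic to $F$, and for each edge $e=uv\in E(B)$, $p^{-1}(\{e\})$ is isomorphic to $F\Box K_2$; here $p^{-1}(\{e\})$ is understood as the subgraph formed by the two fibres over $u$ and $v$ together with all edges of $G$ mapped to $e$, the two fibres corresponding to the two copies of $F$ in $F\Box K_2$, so that the edges mapped to $e$ form a perfect matching between the two fibres inducing a graph isomorphism $\varphi_e:p^{-1}(\{u\})\to p^{-1}(\{v\})$. *)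

theory Defs
  imports Main "HOL-Library.Extended_Nat"
begin

record 'a sgraph =
  verts :: "'a set"
  edges :: "'a set set"

text \<open>Graphs are finite: connectivity numbers and fault diameters are minima and maxima over
  sets of faults of prescribed cardinality.\<close>

definition simple_graph :: "'a sgraph \<Rightarrow> bool" where
  "simple_graph G \<longleftrightarrow>
     finite (verts G) \<and>
     (\<forall>e \<in> edges G. \<exists>u v. e = {u, v} \<and> u \<noteq> v \<and> u \<in> verts G \<and> v \<in> verts G)"

definition is_path :: "'a sgraph \<Rightarrow> 'a \<Rightarrow> 'a list \<Rightarrow> 'a \<Rightarrow> bool" where
  "is_path G x xs y \<longleftrightarrow>
     xs \<noteq> [] \<and> hd xs = x \<and> last xs = y \<and> distinct xs \<and> set xs \<subseteq> verts G \<and>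
     successively (\<lambda>u v. {u, v} \<in> edges G) xs"

text \<open>A path is the list of its vertices, so its length is one less than that of the list.
  The infimum of the empty set is \<open>\<infinity>\<close>.\<close>

definition gdist :: "'a sgraph \<Rightarrow> 'a \<Rightarrow> 'a \<Rightarrow> enat" where
  "gdist G x y = Inf {enat (length xs - 1) | xs. is_path G x xs y}"

text \<open>The lower bound on the number of vertices is the convention that \<open>K\<^sub>1\<close> is disconnected.\<close>

definition connected_graph :: "'a sgraph \<Rightarrow> bool" where
  "connected_graph G \<longleftrightarrow>
     card (verts G) \<ge> 2 \<and> (\<forall>x \<in> verts G. \<forall>y \<in> verts G. \<exists>xs. is_path G x xs y)"

text \<open>Suprema of finite nonempty sets of extended naturals are maxima. The value \<open>\<infinity>\<close> for
  disconnected graphs only makes the function total.\<close>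

definition diameter :: "'a sgraph \<Rightarrow> enat" where
  "diameter G =
     (if connected_graph G then SUP x \<in> verts G. SUP y \<in> verts G. gdist G x y else \<infinity>)"

text \<open>\<open>X\<close> and \<open>Y\<close> are the vertex part and the edge part of the deleted set.\<close>

definition delete :: "'a sgraph \<Rightarrow> 'a set \<Rightarrow> 'a set set \<Rightarrow> 'a sgraph" where
  "delete G X Y =
     \<lparr>verts = verts G - X, edges = {e \<in> edges G - Y. e \<subseteq> verts G - X}\<rparr>"

definition complete_graph :: "'a sgraph \<Rightarrow> bool" where
  "complete_graph G \<longleftrightarrow>
     (\<forall>u \<in> verts G. \<forall>v \<in> verts G. u \<noteq> v \<longrightarrow> {u, v} \<in> edges G)"

text \<open>A disconnected non-complete graph gets connectivity 0, with the empty set as witness.\<close>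

definition connectivity :: "'a sgraph \<Rightarrow> nat" where
  "connectivity G =
     (if complete_graph G then card (verts G) - 1
      else LEAST c. \<exists>X \<subseteq> verts G. card X = c \<and> \<not> connected_graph (delete G X {}))"

definition k_connected :: "nat \<Rightarrow> 'a sgraph \<Rightarrow> bool" where
  "k_connected k G \<longleftrightarrow> 0 < k \<and> k \<le> connectivity G"

definition mixed_connected :: "nat \<Rightarrow> nat \<Rightarrow> 'a sgraph \<Rightarrow> bool" where
  "mixed_connected p q G \<longleftrightarrow>
     connected_graph G \<and>
     (\<forall>X Y. X \<subseteq> verts G \<and> Y \<subseteq> edges G \<and> card X = p \<and> card Y = q \<longrightarrow>
        connected_graph (delete G X Y))"

definition vertex_fault_diameter :: "nat \<Rightarrow> 'a sgraph \<Rightarrow> enat" where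
  "vertex_fault_diameter a G =
     (if a < connectivity G
      then Sup {diameter (delete G X {}) | X. X \<subseteq> verts G \<and> card X = a}
      else \<infinity>)"

text \<open>Here \<open>\<infinity>\<close> only makes the function total: the mixed fault diameter is meant for
  \<open>mixed_connected p q\<close> graphs.\<close>

definition mixed_fault_diameter :: "nat \<Rightarrow> nat \<Rightarrow> 'a sgraph \<Rightarrow> enat" where
  "mixed_fault_diameter p q G =
     (if mixed_connected p q G
      then Sup {diameter (delete G X Y) | X Y.
                  X \<subseteq> verts G \<and> Y \<subseteq> edges G \<and> card X = p \<and> card Y = q}
      else \<infinity>)"

definition cartesian_product :: "'a sgraph \<Rightarrow> 'b sgraph \<Rightarrow> ('a \<times> 'b) sgraph" where
  "cartesian_product G H =
     \<lparr>verts = verts G \<times> verts H,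
      edges = {{(u1, v1), (u2, v2)} | u1 v1 u2 v2.
                 {u1, u2} \<in> edges G \<and> v1 = v2 \<and> v1 \<in> verts H \<or>
                 {v1, v2} \<in> edges H \<and> u1 = u2 \<and> u1 \<in> verts G}\<rparr>"

definition K2 :: "bool sgraph" where
  "K2 = \<lparr>verts = {False, True}, edges = {{False, True}}\<rparr>"

definition graph_iso :: "('a \<Rightarrow> 'b) \<Rightarrow> 'a sgraph \<Rightarrow> 'b sgraph \<Rightarrow> bool" where
  "graph_iso f G H \<longleftrightarrow>
     bij_betw f (verts G) (verts H) \<and>
     (\<forall>x \<in> verts G. \<forall>y \<in> verts G. {x, y} \<in> edges G \<longleftrightarrow> {f x, f y} \<in> edges H)"

text \<open>In the disjoint sums \<open>V + E\<close> below, \<open>Inl\<close> marks vertices and \<open>Inr\<close> marks edges. An edge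
  collapsed to a vertex has both its ends over that vertex; an edge mapped to an edge has its
  ends mapped to the two ends of the image.\<close>

definition graph_map ::
    "'a sgraph \<Rightarrow> 'b sgraph \<Rightarrow> ('a + 'a set \<Rightarrow> 'b + 'b set) \<Rightarrow> bool" where
  "graph_map G B p \<longleftrightarrow>
     (\<forall>x \<in> verts G. \<exists>u \<in> verts B. p (Inl x) = Inl u) \<and>
     (\<forall>x y. {x, y} \<in> edges G \<longrightarrow>
        (\<exists>u \<in> verts B. p (Inr {x, y}) = Inl u \<and> p (Inl x) = Inl u \<and> p (Inl y) = Inl u) \<or>
        (\<exists>u v. {u, v} \<in> edges B \<and> p (Inr {x, y}) = Inr {u, v} \<and>
               p (Inl x) = Inl u \<and> p (Inl y) = Inl v))"

definition vertex_fibre ::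
    "'a sgraph \<Rightarrow> ('a + 'a set \<Rightarrow> 'b + 'b set) \<Rightarrow> 'b \<Rightarrow> 'a sgraph" where
  "vertex_fibre G p v =
     \<lparr>verts = {x \<in> verts G. p (Inl x) = Inl v}, edges = {e \<in> edges G. p (Inr e) = Inl v}\<rparr>"

definition edge_preimage ::
    "'a sgraph \<Rightarrow> ('a + 'a set \<Rightarrow> 'b + 'b set) \<Rightarrow> 'b \<Rightarrow> 'b \<Rightarrow> 'a sgraph" where
  "edge_preimage G p u v =
     \<lparr>verts = verts (vertex_fibre G p u) \<union> verts (vertex_fibre G p v),
      edges = edges (vertex_fibre G p u) \<union> edges (vertex_fibre G p v) \<union>
              {e \<in> edges G. p (Inr e) = Inr {u, v}}\<rparr>"

text \<open>The isomorphism of the preimage of an edge with \<open>F \<box> K\<^sub>2\<close> has to take the two fibres to the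
  two copies of \<open>F\<close>; hence the edges over \<open>uv\<close> form a perfect matching which induces an
  isomorphism between the fibres.\<close>

definition cartesian_bundle :: "'a sgraph \<Rightarrow> 'f sgraph \<Rightarrow> 'b sgraph \<Rightarrow> bool" where
  "cartesian_bundle G F B \<longleftrightarrow>
     (\<exists>p. graph_map G B p \<and>
        (\<forall>v \<in> verts B. \<exists>f. graph_iso f (vertex_fibre G p v) F) \<and>
        (\<forall>u v. {u, v} \<in> edges B \<longrightarrow>
           (\<exists>f. graph_iso f (edge_preimage G p u v) (cartesian_product F K2) \<and>
                f ` verts (vertex_fibre G p u) = verts F \<times> {False} \<and>
                f ` verts (vertex_fibre G p v) = verts F \<times> {True})))"

end

theory Submission
  imports Defs
begin

text \<open>
  Write \<open>dF\<close> and \<open>dB\<close> for the two vertex fault diameters on the right-hand side. Every set \<open>X\<close> of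
  at most \<open>a + b + 1\<close> faulty vertices of \<open>G\<close> has to leave a walk of length at most \<open>dF + dB\<close> between
  any two healthy vertices \<open>x\<close> and \<open>y\<close>; such walks bound the connectivity of \<open>G\<close> as well.

  The hypotheses on the mixed fault diameters say that, after fewer than \<open>a\<close> vertex faults, any two
  distinct vertices of \<open>F\<close> are joined by a path with an inner vertex and of length at most \<open>dF\<close>:
  delete the edge between them as well. The same holds for \<open>B\<close>, \<open>b\<close> and \<open>dB\<close>. This is the
  predicate \<open>resilient\<close>, and it forces \<open>dF\<close> and \<open>dB\<close> to be at least 2.

  Let \<open>u\<close> and \<open>v\<close> be the base vertices below \<open>x\<close> and \<open>y\<close>. If \<open>u = v\<close>, either the fibre has at most
  \<open>a\<close> faults and \<open>x\<close>, \<open>y\<close> are joined inside it, or at most \<open>b\<close> faults lie elsewhere, so that some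
  neighbouring fibre is free of faults and the detour through it costs two extra steps, which
  \<open>dB \<ge> 2\<close> pays for (\<open>reach_same_fibre\<close>).

  If \<open>u \<noteq> v\<close>, count the base vertices other than \<open>u\<close>, \<open>v\<close> that have faults above them. When there
  are fewer than \<open>b\<close>, a path from \<open>u\<close> to \<open>v\<close> avoids all of them and still has an inner vertex; its
  fibre is free of faults, and the whole movement along \<open>F\<close> takes place there
  (\<open>reach_via_clean_fibre\<close>). Otherwise a path from \<open>u\<close> to \<open>v\<close> avoids \<open>b\<close> of them, and at most
  \<open>a + 1\<close> faults lie above this path. The bundle is trivial over a path, so these faults can be
  projected to a single copy of \<open>F\<close>, where their shadow has at most \<open>a + 1\<close> vertices. If the
  \<open>F\<close>-coordinate of \<open>x\<close> or of \<open>y\<close> is outside the shadow, one can move over the path there. If both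
  are inside, only \<open>a - 1\<close> other vertices are in the shadow, and a path between the two coordinates
  in \<open>F\<close> that avoids them has an inner vertex, above which it is safe to move over the path
  (\<open>reach_over_faulty_path\<close>).
\<close>

section \<open>Walks and paths\<close>

text \<open>Here \<open>n\<close> is only an upper bound for the length of the walk. Walks can be concatenated without
  regard to repeated vertices, which makes them more convenient than paths.\<close>

inductive reach :: "'a sgraph \<Rightarrow> nat \<Rightarrow> 'a \<Rightarrow> 'a \<Rightarrow> bool" for H where
  reach_refl: "x \<in> verts H \<Longrightarrow> reach H n x x"
| reach_step: "x \<in> verts H \<Longrightarrow> {x, y} \<in> edges H \<Longrightarrow> reach H n y z \<Longrightarrow> reach H (Suc n) x z"

lemma reach_verts: "reach H n x y \<Longrightarrow> x \<in> verts H \<and> y \<in> verts H"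
  by (induction rule: reach.induct) auto

lemma reach_mono: "reach H m x y \<Longrightarrow> m \<le> n \<Longrightarrow> reach H n x y"
proof (induction arbitrary: n rule: reach.induct)
  case (reach_step x y m z)
  then show ?case by (cases n) (auto intro: reach.reach_step)
qed (auto intro: reach_refl)

lemma reach_trans: "reach H m x y \<Longrightarrow> reach H n y z \<Longrightarrow> reach H (m + n) x z"
  by (induction rule: reach.induct) (auto intro: reach_mono reach.reach_step)

lemma reach_edge: "\<lbrakk>x \<in> verts H; y \<in> verts H; {x, y} \<in> edges H\<rbrakk> \<Longrightarrow> reach H (Suc 0) x y"
  using reach_step[OF _ _ reach_refl[where n = 0]] by fastforce

lemma reach_image:
  assumes "reach H n x y"
    and "\<And>x. x \<in> verts H \<Longrightarrow> f x \<in> verts K"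
    and "\<And>x y. \<lbrakk>x \<in> verts H; y \<in> verts H; {x, y} \<in> edges H\<rbrakk> \<Longrightarrow> {f x, f y} \<in> edges K"
  shows "reach K n (f x) (f y)"
  using assms(1)
proof (induction rule: reach.induct)
  case (reach_step x y n z)
  then show ?case
    using assms(2,3) reach_verts[OF reach_step.hyps(3)] by (blast intro: reach.reach_step)
qed (auto intro: reach_refl assms(2))

lemma path_reach: "is_path H x xs y \<Longrightarrow> length xs \<le> Suc n \<Longrightarrow> reach H n x y"
proof (induction xs arbitrary: x n)
  case (Cons z xs)
  show ?case
  proof (cases xs)
    case Nil
    then show ?thesis using Cons.prems by (auto simp: is_path_def intro: reach_refl)
  next
    case (Cons s ys)
    from Cons.prems \<open>xs = s # ys\<close> obtain m where n: "n = Suc m"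
      by (cases n) auto
    have "is_path H s xs y" "x \<in> verts H" "{x, s} \<in> edges H"
      using Cons.prems \<open>xs = s # ys\<close> by (auto simp: is_path_def)
    with Cons.IH[of s m] Cons.prems n show ?thesis by (auto intro: reach_step)
  qed
qed (simp add: is_path_def)

text \<open>When a new first vertex already occurs on the path, the part before that occurrence is cut
  off.\<close>

lemma reach_path: "reach H n x y \<Longrightarrow> \<exists>xs. is_path H x xs y \<and> length xs \<le> Suc n"
proof (induction rule: reach.induct)
  case (reach_refl x n)
  then show ?case by (intro exI[of _ "[x]"]) (auto simp: is_path_def)
next
  case (reach_step x y n z)
  then obtain xs where xs: "is_path H y xs z" "length xs \<le> Suc n" by blast
  show ?case
  proof (cases "x \<in> set xs")
    case True
    then obtain ys zs where "xs = ys @ x # zs" by (meson split_list)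
    then have "is_path H x (x # zs) z" "length (x # zs) \<le> Suc (Suc n)"
      using xs by (auto simp: is_path_def successively_append_iff)
    then show ?thesis by blast
  next
    case False
    then have "is_path H x (x # xs) z"
      using xs reach_step.hyps by (cases xs) (auto simp: is_path_def)
    then show ?thesis using xs(2) by (intro exI[of _ "x # xs"]) auto
  qed
qed

lemma verts_delete [simp]: "verts (delete H X Y) = verts H - X"
  by (simp add: delete_def)

lemma edges_delete [simp]:
  "edges (delete H X Y) = {e \<in> edges H - Y. e \<subseteq> verts H - X}"
  by (simp add: delete_def)

lemma path_subgraph:
  assumes "is_path H x xs y" "verts H \<subseteq> verts K" "edges H \<subseteq> edges K"
  shows "is_path K x xs y"
  using assms by (auto simp: is_path_def intro: successively_mono)

section \<open>Diameter and connectivity\<close>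

lemma short_path_if_diameter_le:
  assumes "diameter H \<le> enat n" "x \<in> verts H" "y \<in> verts H"
  shows "\<exists>xs. is_path H x xs y \<and> length xs \<le> Suc n"
proof -
  have con: "connected_graph H" using assms(1) by (auto simp: diameter_def split: if_splits)
  then have "gdist H x y \<le> diameter H"
    using assms(2,3) by (simp add: diameter_def) (blast intro: SUP_upper2 SUP_upper)
  then have le: "gdist H x y \<le> enat n" using assms(1) by order
  let ?L = "{enat (length xs - 1) | xs. is_path H x xs y}"
  have "?L \<noteq> {}" using con assms(2,3) by (auto simp: connected_graph_def)
  then have "Inf ?L \<in> ?L"
    unfolding Inf_enat_def by (metis (mono_tags, lifting) LeastI_ex ex_in_conv)
  with le show ?thesis by (fastforce simp: gdist_def)
qed

lemma connected_if_reach: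
  assumes "2 \<le> card (verts H)" "\<And>x y. \<lbrakk>x \<in> verts H; y \<in> verts H\<rbrakk> \<Longrightarrow> reach H n x y"
  shows "connected_graph H"
  using assms reach_path unfolding connected_graph_def by meson

lemma diameter_le_if_reach:
  assumes "2 \<le> card (verts H)" "\<And>x y. \<lbrakk>x \<in> verts H; y \<in> verts H\<rbrakk> \<Longrightarrow> reach H n x y"
  shows "diameter H \<le> enat n"
proof -
  have "gdist H x y \<le> enat n" if xy: "x \<in> verts H" "y \<in> verts H" for x y
  proof -
    obtain xs where xs: "is_path H x xs y" "length xs \<le> Suc n"
      using reach_path[OF assms(2)[OF xy]] by blast
    have "gdist H x y \<le> enat (length xs - 1)"
      unfolding gdist_def using xs(1) by (auto intro: Inf_lower)
    also have "\<dots> \<le> enat n" using xs(2) by auto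
    finally show ?thesis .
  qed
  then show ?thesis
    using connected_if_reach[OF assms] by (auto simp: diameter_def intro!: SUP_least)
qed

text \<open>A path has no repeated vertices, so the diameter of a finite connected graph is finite.\<close>

lemma diameter_le_card:
  assumes "connected_graph H" "finite (verts H)"
  shows "diameter H \<le> enat (card (verts H))"
proof (rule diameter_le_if_reach)
  fix x y assume "x \<in> verts H" "y \<in> verts H"
  then obtain xs where xs: "is_path H x xs y" using assms by (auto simp: connected_graph_def)
  then have "length xs \<le> card (verts H)"
    using assms(2) by (metis card_mono distinct_card is_path_def)
  then show "reach H (card (verts H)) x y" using path_reach[OF xs] by simp
qed (use assms in \<open>simp add: connected_graph_def\<close>)

lemma connected_delete_if_less_connectivity:
  assumes "finite (verts H)" "a < connectivity H" "X \<subseteq> verts H" "card X = a"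
  shows "connected_graph (delete H X {})"
proof (cases "complete_graph H")
  case True
  then have c: "2 \<le> card (verts H - X)"
    using assms by (simp add: connectivity_def card_Diff_subset finite_subset)
  show ?thesis
  proof (rule connected_if_reach[where n = 1])
    fix x y assume "x \<in> verts (delete H X {})" "y \<in> verts (delete H X {})"
    then show "reach (delete H X {}) 1 x y"
      using True reach_edge[of x "delete H X {}" y]
      by (cases "x = y") (auto simp: complete_graph_def intro: reach_refl)
  qed (use c in simp)
next
  case False
  then have "a < (LEAST c. \<exists>X \<subseteq> verts H. card X = c \<and> \<not> connected_graph (delete H X {}))"
    using assms by (simp add: connectivity_def)
  from not_less_Least[OF this] assms show ?thesis by blast
qed

text \<open>Deleting all vertices but one always disconnects, by the convention that \<open>K\<^sub>1\<close> is
  disconnected.\<close>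

lemma card_verts_if_less_connectivity:
  assumes "finite (verts H)" "a < connectivity H"
  shows "a + 2 \<le> card (verts H)"
proof (rule ccontr)
  assume "\<not> a + 2 \<le> card (verts H)"
  then have small: "card (verts H) - 1 \<le> a" by simp
  obtain X where X: "X \<subseteq> verts H" "card X = card (verts H) - 1"
    using obtain_subset_with_card_n[of "card (verts H) - 1" "verts H"] by (metis diff_le_self)
  then have "connected_graph (delete H X {})"
    using connected_delete_if_less_connectivity[OF assms(1) _ X] small assms(2) by simp
  then have "2 \<le> card (verts H - X)" by (simp add: connected_graph_def)
  then show False using X assms(1) by (simp add: card_Diff_subset finite_subset)
qed

lemma vertex_fault_diameter_finite:
  assumes "finite (verts H)" "a < connectivity H"
  obtains d where "vertex_fault_diameter a H = enat d"
proof -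
  have "diameter (delete H X {}) \<le> enat (card (verts H))" if "X \<subseteq> verts H" "card X = a" for X
  proof -
    have "diameter (delete H X {}) \<le> enat (card (verts H - X))"
      using diameter_le_card[OF connected_delete_if_less_connectivity[OF assms that]] assms(1)
      by simp
    also have "\<dots> \<le> enat (card (verts H))" using assms(1) by (simp add: card_mono)
    finally show ?thesis .
  qed
  then have "vertex_fault_diameter a H \<le> enat (card (verts H))"
    using assms(2) by (auto simp: vertex_fault_diameter_def intro!: Sup_least)
  then show ?thesis using that enat_ile by blast
qed

section \<open>Resilience\<close>

text \<open>The path in the last clause avoids the edge between its ends, so it has an inner vertex. Faults
  are bounded in number rather than counted exactly, since the arguments below only produce upper
  bounds for them.\<close>

definition resilient :: "'a sgraph \<Rightarrow> nat \<Rightarrow> nat \<Rightarrow> bool" where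
  "resilient H c d \<longleftrightarrow>
     finite (verts H) \<and> 0 < c \<and> c + 2 \<le> card (verts H) \<and>
     (\<forall>X x y. X \<subseteq> verts H \<and> card X \<le> c \<and> x \<in> verts H - X \<and> y \<in> verts H - X \<longrightarrow>
        (\<exists>xs. is_path (delete H X {}) x xs y \<and> length xs \<le> Suc d)) \<and>
     (\<forall>X x y. X \<subseteq> verts H \<and> card X < c \<and> x \<in> verts H - X \<and> y \<in> verts H - X \<and> x \<noteq> y \<longrightarrow>
        (\<exists>xs. is_path (delete H X {{x, y}}) x xs y \<and> length xs \<le> Suc d))"

text \<open>Fault diameters speak of exactly \<open>c\<close> faults. A smaller fault set is filled up with vertices
  different from the two that are to be joined.\<close>

lemma enlarge_avoiding:
  assumes "finite V" "c + 2 \<le> card V" "X \<subseteq> V - {x, y}" "card X \<le> c"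
  obtains X' where "X \<subseteq> X'" "X' \<subseteq> V - {x, y}" "card X' = c"
proof -
  have "card V - card {x, y} \<le> card (V - {x, y})" by (rule diff_card_le_card_Diff) simp
  moreover have "card {x, y} \<le> 2" by (simp add: card_insert_if)
  ultimately have "c \<le> card (V - {x, y})" using assms(2) by linarith
  with exists_subset_between[OF assms(4) this assms(3)] assms(1) that show thesis by auto
qed

lemma diameter_le_mixed_fault_diameter:
  assumes "X \<subseteq> verts H" "Y \<subseteq> edges H" "card X = p" "card Y = q"
  shows "diameter (delete H X Y) \<le> mixed_fault_diameter p q H"
proof (cases "mixed_connected p q H")
  case True
  have "diameter (delete H X Y) \<in> {diameter (delete H X Y) | X Y.
          X \<subseteq> verts H \<and> Y \<subseteq> edges H \<and> card X = p \<and> card Y = q}"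
    using assms by blast
  with True show ?thesis unfolding mixed_fault_diameter_def by (simp add: Sup_upper)
qed (simp add: mixed_fault_diameter_def)

text \<open>If \<open>x\<close> and \<open>y\<close> are not adjacent, deleting the pair \<open>{x, y}\<close> changes nothing and
  the bound for vertex faults applies.\<close>

lemma resilientI:
  assumes fin: "finite (verts H)" and a: "0 < a" "a < connectivity H"
    and d: "vertex_fault_diameter a H = enat d"
    and mix: "mixed_fault_diameter (a - 1) 1 H \<le> vertex_fault_diameter a H"
  shows "resilient H a d"
proof -
  note card = card_verts_if_less_connectivity[OF fin a(2)]
  have vertex: "\<exists>xs. is_path (delete H X {}) x xs y \<and> length xs \<le> Suc d"
    if X: "X \<subseteq> verts H" "card X \<le> a" and xy: "x \<in> verts H - X" "y \<in> verts H - X" for X x y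
  proof -
    obtain X' where X': "X \<subseteq> X'" "X' \<subseteq> verts H - {x, y}" "card X' = a"
      by (rule enlarge_avoiding[OF fin card, of X x y]) (use X xy in auto)
    have "diameter (delete H X' {}) \<le> vertex_fault_diameter a H"
      unfolding vertex_fault_diameter_def using a(2) X' by (auto intro!: Sup_upper)
    then obtain xs where "is_path (delete H X' {}) x xs y" "length xs \<le> Suc d"
      using short_path_if_diameter_le[of "delete H X' {}" d x y] d xy X' by auto
    moreover have "is_path (delete H X {}) x xs y"
      by (rule path_subgraph[OF calculation(1)]) (use X' in auto)
    ultimately show ?thesis by blast
  qed
  have mixed: "\<exists>xs. is_path (delete H X {{x, y}}) x xs y \<and> length xs \<le> Suc d"
    if X: "X \<subseteq> verts H" "card X < a"
      and xy: "x \<in> verts H - X" "y \<in> verts H - X" "x \<noteq> y" for X x y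
  proof (cases "{x, y} \<in> edges H")
    case True
    obtain X' where X': "X \<subseteq> X'" "X' \<subseteq> verts H - {x, y}" "card X' = a - 1"
    proof (rule enlarge_avoiding[OF fin])
      show "a - 1 + 2 \<le> card (verts H)" "card X \<le> a - 1" using card X a(1) by linarith+
      show "X \<subseteq> verts H - {x, y}" using X xy by blast
    qed
    have "diameter (delete H X' {{x, y}}) \<le> mixed_fault_diameter (a - 1) 1 H"
      by (rule diameter_le_mixed_fault_diameter) (use X' True in auto)
    then have "diameter (delete H X' {{x, y}}) \<le> enat d" using mix d by simp
    then obtain xs where "is_path (delete H X' {{x, y}}) x xs y" "length xs \<le> Suc d"
      using short_path_if_diameter_le[of "delete H X' {{x, y}}" d x y] xy X' by auto
    moreover have "is_path (delete H X {{x, y}}) x xs y"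
      by (rule path_subgraph[OF calculation(1)]) (use X' in auto)
    ultimately show ?thesis by blast
  next
    case False
    then have "delete H X {{x, y}} = delete H X {}" by (auto simp: delete_def)
    then show ?thesis using vertex[of X x y] X xy by simp
  qed
  show ?thesis unfolding resilient_def
    by (intro conjI allI impI; (elim conjE)?) (fact fin a(1) card vertex mixed)+
qed

lemma resilient_path:
  assumes "resilient H c d" "finite X" "card X \<le> c" "x \<in> verts H - X" "y \<in> verts H - X"
  obtains xs where "is_path (delete H X {}) x xs y" "length xs \<le> Suc d"
proof -
  have "card (X \<inter> verts H) \<le> card X" using assms(2) by (rule card_mono) simp
  then have "X \<inter> verts H \<subseteq> verts H \<and> card (X \<inter> verts H) \<le> c \<and>
      x \<in> verts H - X \<inter> verts H \<and> y \<in> verts H - X \<inter> verts H"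
    using assms(3-5) by simp
  then have "\<exists>xs. is_path (delete H (X \<inter> verts H) {}) x xs y \<and> length xs \<le> Suc d"
    using assms(1) unfolding resilient_def by meson
  moreover have "delete H (X \<inter> verts H) {} = delete H X {}" by (auto simp: delete_def)
  ultimately show thesis using that by auto
qed

lemma resilient_reach:
  assumes "resilient H c d" "finite X" "card X \<le> c" "x \<in> verts H - X" "y \<in> verts H - X"
  shows "reach (delete H X {}) d x y"
  by (rule resilient_path[OF assms]) (rule path_reach)

lemma resilient_detour:
  assumes "resilient H c d" "X \<subseteq> verts H" "card X < c"
    and "x \<in> verts H - X" "y \<in> verts H - X" "x \<noteq> y"
  obtains s zs where "is_path (delete H X {}) x (x # s # zs) y"
    "length (x # s # zs) \<le> Suc d" "s \<noteq> x" "s \<noteq> y" "zs \<noteq> []"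
proof -
  obtain xs where xs: "is_path (delete H X {{x, y}}) x xs y" "length xs \<le> Suc d"
    using assms unfolding resilient_def by meson
  then obtain s zs where xs_eq: "xs = x # s # zs"
    using assms(6) by (cases xs; cases "tl xs") (auto simp: is_path_def)
  have "is_path (delete H X {}) x xs y" by (rule path_subgraph[OF xs(1)]) auto
  moreover have "s \<noteq> x" "s \<noteq> y" using xs(1) by (auto simp: is_path_def xs_eq)
  moreover have "zs \<noteq> []" using xs(1) \<open>s \<noteq> y\<close> by (auto simp: is_path_def xs_eq)
  ultimately show thesis using that xs(2) unfolding xs_eq by blast
qed

text \<open>The second vertex of a path to any other healthy vertex is the neighbour; such
  a vertex exists because \<open>H\<close> has at least \<open>c + 2\<close> vertices.\<close>

lemma resilient_neighbour:
  assumes "resilient H c d" "finite X" "card X \<le> c" "x \<in> verts H - X"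
  obtains s where "s \<in> verts H - X" "s \<noteq> x" "{x, s} \<in> edges H"
proof -
  have "card (insert x X) < card (verts H)"
    using assms by (auto simp: resilient_def card_insert_if)
  then obtain y where y: "y \<in> verts H - X" "y \<noteq> x"
    using assms(2) by (metis DiffI card_mono finite_insert insert_iff not_le subsetI)
  obtain xs where xs: "is_path (delete H X {}) x xs y" using resilient_path[OF assms y(1)] .
  then obtain s zs where xs_eq: "xs = x # s # zs"
    using y(2) by (cases xs; cases "tl xs") (auto simp: is_path_def)
  then show thesis using xs that[of s] by (auto simp: is_path_def)
qed

lemma resilient_bound_ge_2:
  assumes "resilient H c d"
  shows "2 \<le> d"
proof -
  have "\<not> card (verts H) \<le> Suc 0" using assms by (auto simp: resilient_def)
  then obtain x y where xy: "x \<in> verts H" "y \<in> verts H" "x \<noteq> y"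
    by (metis assms card_le_Suc0_iff_eq resilient_def)
  have "card ({} :: 'a set) < c" using assms by (simp add: resilient_def)
  then obtain s zs where "length (x # s # zs) \<le> Suc d" "zs \<noteq> []"
    by (rule resilient_detour[OF assms, of "{}" x y, rotated]) (use xy in auto)
  then show ?thesis by (cases zs) auto
qed

section \<open>Charts of a bundle\<close>

text \<open>A chart need not reflect edges: walks are only ever carried from \<open>F\<close> into a fibre.\<close>

definition fibre_chart ::
    "'g sgraph \<Rightarrow> 'f sgraph \<Rightarrow> ('g \<Rightarrow> 'b) \<Rightarrow> 'b \<Rightarrow> ('f \<Rightarrow> 'g) \<Rightarrow> bool" where
  "fibre_chart G F \<pi> v h \<longleftrightarrow>
     bij_betw h (verts F) {x \<in> verts G. \<pi> x = v} \<and>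
     (\<forall>s t. {s, t} \<in> edges F \<longrightarrow> {h s, h t} \<in> edges G)"

text \<open>The last clause carries a chart across a base edge along the matching between the two
  fibres. Together with the existence of charts, it is all the routing needs to know about
  the bundle.\<close>

definition fibre_projection ::
    "'g sgraph \<Rightarrow> 'f sgraph \<Rightarrow> 'b sgraph \<Rightarrow> ('g \<Rightarrow> 'b) \<Rightarrow> bool" where
  "fibre_projection G F B \<pi> \<longleftrightarrow>
     (\<forall>x \<in> verts G. \<pi> x \<in> verts B) \<and>
     (\<forall>v \<in> verts B. \<exists>h. fibre_chart G F \<pi> v h) \<and>
     (\<forall>u v h. {u, v} \<in> edges B \<and> fibre_chart G F \<pi> u h \<longrightarrow>
        (\<exists>h'. fibre_chart G F \<pi> v h' \<and> (\<forall>s \<in> verts F. {h s, h' s} \<in> edges G)))"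

lemma simple_graph_edgeD:
  assumes "simple_graph H" "{x, y} \<in> edges H"
  shows "x \<in> verts H" "y \<in> verts H" "x \<noteq> y"
  using assms by (auto simp: simple_graph_def doubleton_eq_iff insert_commute)

lemma cartesian_product_K2_edges:
  "{(s, i), (t, i)} \<in> edges (cartesian_product F K2) \<longleftrightarrow> {s, t} \<in> edges F"
  "s \<in> verts F \<Longrightarrow> {(s, False), (s, True)} \<in> edges (cartesian_product F K2)"
  by (auto simp: cartesian_product_def K2_def doubleton_eq_iff insert_commute)

text \<open>The isomorphism \<open>f\<close> of the preimage of an edge with \<open>F \<box> K\<^sub>2\<close> carries a chart across the edge:
  follow \<open>h\<close> by \<open>f\<close> into the first copy of \<open>F\<close>, change the copy, and return by the inverse of
  \<open>f\<close>.\<close>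

lemma fibre_projection_if_bundle:
  assumes F: "simple_graph F" and B: "simple_graph B" and GFB: "cartesian_bundle G F B"
  obtains \<pi> where "fibre_projection G F B \<pi>"
proof -
  obtain p where map: "graph_map G B p"
    and fib: "\<forall>v \<in> verts B. \<exists>f. graph_iso f (vertex_fibre G p v) F"
    and edg: "\<forall>u v. {u, v} \<in> edges B \<longrightarrow>
           (\<exists>f. graph_iso f (edge_preimage G p u v) (cartesian_product F K2) \<and>
                f ` verts (vertex_fibre G p u) = verts F \<times> {False} \<and>
                f ` verts (vertex_fibre G p v) = verts F \<times> {True})"
    using GFB unfolding cartesian_bundle_def by (elim exE conjE) (rule that)
  define \<pi> where "\<pi> x = projl (p (Inl x))" for x
  have p_Inl: "p (Inl x) = Inl (\<pi> x) \<and> \<pi> x \<in> verts B" if x: "x \<in> verts G" for x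
  proof -
    obtain u where "u \<in> verts B" "p (Inl x) = Inl u"
      using map x unfolding graph_map_def by meson
    then show ?thesis by (simp add: \<pi>_def)
  qed
  have V: "verts (vertex_fibre G p v) = {x \<in> verts G. \<pi> x = v}" for v
    using p_Inl by (auto simp: vertex_fibre_def)
  have "\<exists>h. fibre_chart G F \<pi> v h" if v: "v \<in> verts B" for v
  proof -
    obtain f where f: "graph_iso f (vertex_fibre G p v) F" using fib v by blast
    define h where "h = inv_into (verts (vertex_fibre G p v)) f"
    have bij: "bij_betw f (verts (vertex_fibre G p v)) (verts F)"
      using f by (simp add: graph_iso_def)
    have hb: "bij_betw h (verts F) (verts (vertex_fibre G p v))"
      unfolding h_def by (rule bij_betw_inv_into[OF bij])
    have "{h s, h t} \<in> edges G" if st: "{s, t} \<in> edges F" for s t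
    proof -
      note st' = simple_graph_edgeD(1,2)[OF F st]
      have "f (h s) = s" "f (h t) = t"
        unfolding h_def by (rule bij_betw_inv_into_right[OF bij], rule st')+
      moreover have "h s \<in> verts (vertex_fibre G p v)" "h t \<in> verts (vertex_fibre G p v)"
        using hb st' by (auto dest: bij_betwE)
      ultimately have "{h s, h t} \<in> edges (vertex_fibre G p v)"
        using f st unfolding graph_iso_def by metis
      then show ?thesis by (simp add: vertex_fibre_def)
    qed
    then show ?thesis using hb unfolding fibre_chart_def V by blast
  qed
  moreover have "\<exists>h'. fibre_chart G F \<pi> v h' \<and> (\<forall>s \<in> verts F. {h s, h' s} \<in> edges G)"
    if uv: "{u, v} \<in> edges B" and h: "fibre_chart G F \<pi> u h" for u v h
  proof -
    let ?U = "verts (vertex_fibre G p u)" and ?V = "verts (vertex_fibre G p v)"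
    let ?E = "edge_preimage G p u v"
    obtain f where f: "graph_iso f ?E (cartesian_product F K2)"
      and fu: "f ` ?U = verts F \<times> {False}" and fv: "f ` ?V = verts F \<times> {True}"
      using edg[rule_format, OF uv] by blast
    have VE: "verts ?E = ?U \<union> ?V" by (simp add: edge_preimage_def)
    have EG: "edges ?E \<subseteq> edges G" by (auto simp: edge_preimage_def vertex_fibre_def)
    have inj: "inj_on f (?U \<union> ?V)"
      using f VE by (simp add: graph_iso_def bij_betw_def)
    have iso: "{x, y} \<in> edges ?E \<longleftrightarrow> {f x, f y} \<in> edges (cartesian_product F K2)"
      if "x \<in> ?U \<union> ?V" "y \<in> ?U \<union> ?V" for x y
      using f that VE unfolding graph_iso_def by blast
    have bf: "bij_betw f ?U (verts F \<times> {False})" "bij_betw f ?V (verts F \<times> {True})"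
      using inj fu fv by (auto simp: bij_betw_def inj_on_def)
    have hb: "bij_betw h (verts F) ?U" using h by (simp add: fibre_chart_def V)
    define g where "g s = fst (f (h s))" for s
    have fh: "f (h s) = (g s, False)" and gs: "g s \<in> verts F" and hs: "h s \<in> ?U"
      if "s \<in> verts F" for s
    proof -
      show "h s \<in> ?U" using hb that by (auto dest: bij_betwE)
      then have "f (h s) \<in> verts F \<times> {False}" using fu by blast
      then show "f (h s) = (g s, False)" "g s \<in> verts F" by (auto simp: g_def)
    qed
    have gb: "bij_betw g (verts F) (verts F)"
    proof -
      have "bij_betw (fst \<circ> (f \<circ> h)) (verts F) (verts F)"
        by (rule bij_betw_trans[OF bij_betw_trans[OF hb bf(1)]]) (auto simp: bij_betw_def inj_on_def)
      then show ?thesis by (simp add: g_def[abs_def] comp_def)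
    qed
    define k where "k s = inv_into ?V f (s, True)" for s
    have fk: "f (k s) = (s, True)" and kV: "k s \<in> ?V" if "s \<in> verts F" for s
      using that fv unfolding k_def by (auto intro!: f_inv_into_f inv_into_into)
    have kb: "bij_betw k (verts F) ?V"
    proof -
      have "bij_betw (inv_into ?V f \<circ> (\<lambda>s. (s, True))) (verts F) ?V"
        by (rule bij_betw_trans[OF _ bij_betw_inv_into[OF bf(2)]]) (auto simp: bij_betw_def inj_on_def)
      then show ?thesis by (simp add: k_def[abs_def] comp_def)
    qed
    \<comment> \<open>An edge of \<open>G\<close> inside a fibre is collapsed to a vertex, since \<open>B\<close> has no loops.\<close>
    have inside: "{x, y} \<in> edges ?E" if xyG: "{x, y} \<in> edges G" and xyU: "x \<in> ?U" "y \<in> ?U" for x y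
    proof -
      have xy: "p (Inl x) = Inl u" "p (Inl y) = Inl u"
        using xyU by (auto simp: vertex_fibre_def)
      consider w where "p (Inr {x, y}) = Inl w" "p (Inl x) = Inl w"
        | w w' where "{w, w'} \<in> edges B" "p (Inl x) = Inl w" "p (Inl y) = Inl w'"
        using map xyG unfolding graph_map_def by meson
      then have "p (Inr {x, y}) = Inl u"
        using xy by cases (use simple_graph_edgeD(3)[OF B] in fastforce)+
      then show ?thesis using xyG by (simp add: edge_preimage_def vertex_fibre_def)
    qed
    have "{k (g s), k (g t)} \<in> edges G" if st: "{s, t} \<in> edges F" for s t
    proof -
      note st' = simple_graph_edgeD(1,2)[OF F st]
      have "{h s, h t} \<in> edges G" using h st by (simp add: fibre_chart_def)
      then have "{f (h s), f (h t)} \<in> edges (cartesian_product F K2)"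
        using iso[of "h s" "h t"] inside hs st' by simp
      then have "{g s, g t} \<in> edges F" using fh st' cartesian_product_K2_edges(1) by metis
      then have "{f (k (g s)), f (k (g t))} \<in> edges (cartesian_product F K2)"
        using fk gs st' cartesian_product_K2_edges(1) by metis
      then show ?thesis using iso[of "k (g s)" "k (g t)"] kV gs st' EG by auto
    qed
    moreover have "bij_betw (\<lambda>s. k (g s)) (verts F) {x \<in> verts G. \<pi> x = v}"
      using bij_betw_trans[OF gb kb] by (simp add: comp_def V)
    moreover have "{h s, k (g s)} \<in> edges G" if "s \<in> verts F" for s
    proof -
      have "{f (h s), f (k (g s))} \<in> edges (cartesian_product F K2)"
        using fh fk gs that cartesian_product_K2_edges(2) by metis
      then show ?thesis using iso[of "h s" "k (g s)"] kV gs hs that EG by auto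
    qed
    ultimately show ?thesis
      unfolding fibre_chart_def by (intro exI[of _ "\<lambda>s. k (g s)"]) auto
  qed
  ultimately have "fibre_projection G F B \<pi>"
    using p_Inl unfolding fibre_projection_def by (intro conjI ballI allI impI) auto
  then show thesis using that by blast
qed

definition charts_along ::
    "'g sgraph \<Rightarrow> 'f sgraph \<Rightarrow> ('g \<Rightarrow> 'b) \<Rightarrow> 'b list \<Rightarrow> ('b \<Rightarrow> 'f \<Rightarrow> 'g) \<Rightarrow> bool" where
  "charts_along G F \<pi> ws h \<longleftrightarrow>
     (\<forall>w \<in> set ws. fibre_chart G F \<pi> w (h w)) \<and>
     successively (\<lambda>w w'. \<forall>s \<in> verts F. {h w s, h w' s} \<in> edges G) ws"

text \<open>The bundle is trivial over a path: charts are carried from each vertex to the previous one.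
  As no vertex is met twice, they never have to agree with an earlier choice.\<close>

lemma charts_along_path:
  assumes "fibre_projection G F B \<pi>"
    and "ws \<noteq> []" "distinct ws" "set ws \<subseteq> verts B" "successively (\<lambda>u v. {u, v} \<in> edges B) ws"
  shows "\<exists>h. charts_along G F \<pi> ws h"
  using assms(2-)
proof (induction ws)
  case (Cons w ws)
  show ?case
  proof (cases ws)
    case Nil
    obtain k where "fibre_chart G F \<pi> w k"
      using assms(1) Cons.prems by (auto simp: fibre_projection_def)
    then show ?thesis using Nil by (intro exI[of _ "\<lambda>_. k"]) (simp add: charts_along_def)
  next
    case (Cons w' us)
    then obtain h where h: "charts_along G F \<pi> ws h" using Cons.IH Cons.prems by auto
    have "fibre_chart G F \<pi> w' (h w')" "{w', w} \<in> edges B"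
      using h Cons Cons.prems by (auto simp: charts_along_def insert_commute)
    then obtain k where k: "fibre_chart G F \<pi> w k" "\<forall>s \<in> verts F. {h w' s, k s} \<in> edges G"
      using assms(1) unfolding fibre_projection_def by blast
    have w: "w \<notin> set ws" using Cons.prems by simp
    have "successively (\<lambda>v v'. \<forall>s \<in> verts F. {(h(w := k)) v s, (h(w := k)) v' s} \<in> edges G) ws"
      using h w unfolding charts_along_def by (auto elim!: successively_cong[THEN iffD1, rotated -1])
    then have "charts_along G F \<pi> (w # ws) (h(w := k))"
      using h k w Cons by (auto simp: charts_along_def insert_commute)
    then show ?thesis by blast
  qed
qed simp

section \<open>Routing around the faults\<close>

locale faulty_bundle =
  fixes G :: "'g sgraph" and F :: "'f sgraph" and B :: "'b sgraph" and \<pi> :: "'g \<Rightarrow> 'b"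
    and a b dF dB :: nat and X :: "'g set"
  assumes resF: "resilient F a dF" and resB: "resilient B b dB"
    and proj: "fibre_projection G F B \<pi>"
    and finX: "finite X" and cardX: "card X \<le> a + b + 1"
begin

abbreviation "G' \<equiv> delete G X {}"

lemma chart_vertex:
  "fibre_chart G F \<pi> w h \<Longrightarrow> s \<in> verts F \<Longrightarrow> h s \<in> verts G \<and> \<pi> (h s) = w"
  by (auto simp: fibre_chart_def dest: bij_betwE)

text \<open>A row is a fibre, seen through its chart; a column is a base path lifted at a fixed coordinate
  in \<open>F\<close>.\<close>

lemma row_reach:
  assumes h: "fibre_chart G F \<pi> w h" and r: "reach (delete F Z {}) n s t"
    and Z: "\<And>s. s \<in> verts F - Z \<Longrightarrow> h s \<notin> X"
  shows "reach G' n (h s) (h t)"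
  by (rule reach_image[OF r]) (use h Z chart_vertex[OF h] in \<open>auto simp: fibre_chart_def\<close>)

text \<open>The faults of the fibre are pulled back to at most \<open>a\<close> faults of \<open>F\<close>.\<close>

lemma row_reach_few_faults:
  assumes h: "fibre_chart G F \<pi> w h" and few: "card {x \<in> X. \<pi> x = w} \<le> a"
    and st: "s \<in> verts F" "t \<in> verts F" "h s \<notin> X" "h t \<notin> X"
  shows "reach G' dF (h s) (h t)"
proof -
  let ?Z = "{s \<in> verts F. h s \<in> X}"
  have fin: "finite ?Z" using resF by (simp add: resilient_def)
  have "inj_on h ?Z" using h by (auto simp: fibre_chart_def bij_betw_def inj_on_def)
  then have "card ?Z \<le> card {x \<in> X. \<pi> x = w}"
    by (rule card_inj_on_le) (use chart_vertex[OF h] finX in auto)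
  then have "reach (delete F ?Z {}) dF s t"
    using resilient_reach[OF resF fin] few st by simp
  then show ?thesis by (rule row_reach[OF h]) auto
qed

lemma column_reach:
  assumes "charts_along G F \<pi> ws h" "ws \<noteq> []" "s \<in> verts F" "\<And>w. w \<in> set ws \<Longrightarrow> h w s \<notin> X"
  shows "reach G' (length ws - 1) (h (hd ws) s) (h (last ws) s)"
  using assms(1,2,4)
proof (induction ws)
  case (Cons w ws)
  have w: "h w s \<in> verts G'"
    using Cons.prems chart_vertex[OF _ assms(3)] by (auto simp: charts_along_def)
  show ?case
  proof (cases ws)
    case Nil
    then show ?thesis using w by (auto intro: reach_refl)
  next
    case (Cons w' us)
    have c: "charts_along G F \<pi> ws h"
      using Cons.prems(1) Cons by (auto simp: charts_along_def)
    then have r: "reach G' (length ws - 1) (h w' s) (h (last ws) s)"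
      using Cons.IH Cons.prems Cons by auto
    have "{h w s, h w' s} \<in> edges G"
      using Cons.prems(1) Cons assms(3) by (auto simp: charts_along_def)
    then have "{h w s, h w' s} \<in> edges G'" using w reach_verts[OF r] by auto
    from reach_step[OF w this r] show ?thesis using Cons by simp
  qed
qed simp

lemma coordinate:
  assumes "fibre_chart G F \<pi> w h" "x \<in> verts G" "\<pi> x = w"
  obtains s where "s \<in> verts F" "h s = x"
proof -
  have "x \<in> h ` verts F" using assms by (simp add: fibre_chart_def bij_betw_def)
  then show thesis using that by blast
qed

lemma charts_along_base_path:
  assumes "is_path (delete B Q Y) u ws v"
  obtains h where "charts_along G F \<pi> ws h"
  using charts_along_path[OF proj, of ws] path_subgraph[OF assms, of B] that
  by (fastforce simp: is_path_def)

text \<open>If more than \<open>a\<close> faults are in the common fibre, at most \<open>b\<close> are elsewhere, so some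
  neighbouring fibre has none.\<close>

lemma reach_same_fibre:
  assumes x: "x \<in> verts G'" and y: "y \<in> verts G'" and eq: "\<pi> x = \<pi> y"
  shows "reach G' (dF + dB) x y"
proof -
  define u where "u = \<pi> x"
  have u: "u \<in> verts B" using x proj by (simp add: u_def fibre_projection_def)
  then obtain h where h: "fibre_chart G F \<pi> u h" using proj by (auto simp: fibre_projection_def)
  obtain s where s: "s \<in> verts F" "h s = x" using coordinate[OF h] x u_def by auto
  obtain t where t: "t \<in> verts F" "h t = y" using coordinate[OF h] y u_def eq by auto
  show ?thesis
  proof (cases "card {x \<in> X. \<pi> x = u} \<le> a")
    case True
    then have "reach G' dF x y" using row_reach_few_faults[OF h, of s t] s t x y by simp
    then show ?thesis by (rule reach_mono) simp
  next
    case False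
    let ?Q = "\<pi> ` {x \<in> X. \<pi> x \<noteq> u}"
    have "card X = card {x \<in> X. \<pi> x = u} + card {x \<in> X. \<pi> x \<noteq> u}"
      using finX by (subst card_Un_disjoint[symmetric]) (auto intro!: arg_cong[of _ _ card])
    then have "card {x \<in> X. \<pi> x \<noteq> u} \<le> b" using False cardX by simp
    then have "card ?Q \<le> b" using finX card_image_le[of "{x \<in> X. \<pi> x \<noteq> u}" \<pi>] by simp
    then obtain w where w: "w \<in> verts B - ?Q" "w \<noteq> u" "{u, w} \<in> edges B"
      by (rule resilient_neighbour[OF resB, of ?Q u, rotated]) (use u finX in auto)
    then obtain k where k: "fibre_chart G F \<pi> w k" "\<forall>s \<in> verts F. {h s, k s} \<in> edges G"
      using proj h unfolding fibre_projection_def by blast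
    have clean: "k s \<in> verts G'" if "s \<in> verts F" for s
      using chart_vertex[OF k(1) that] w by auto
    have "{x \<in> X. \<pi> x = w} = {}" using w by auto
    then have "card {x \<in> X. \<pi> x = w} \<le> a" by (simp only: card.empty)
    then have "reach G' dF (k s) (k t)"
      using row_reach_few_faults[OF k(1)] s t clean by simp
    moreover have "reach G' 1 x (k s)" "reach G' 1 (k t) y"
      using k(2) s t x y clean by (auto intro!: reach_edge simp: insert_commute)
    ultimately have "reach G' (1 + dF + 1) x y" using reach_trans by metis
    then show ?thesis by (rule reach_mono) (use resilient_bound_ge_2[OF resB] in simp)
  qed
qed

text \<open>All faults above the path are in its first and last fibre. Hence the fibre above \<open>w\<close> is free
  of faults, and so are the inner vertices of the path lifted at any coordinate. The walk makes its first step at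
  coordinate \<open>s\<close>, changes to \<open>t\<close> above \<open>w\<close>, and follows the rest of the path there.\<close>

lemma reach_via_clean_fibre:
  assumes ch: "charts_along G F \<pi> (u # w # ws) h" and len: "length (u # w # ws) \<le> Suc dB"
    and clean: "\<And>x. x \<in> X \<Longrightarrow> \<pi> x \<in> set (u # w # ws) \<Longrightarrow> \<pi> x \<in> {u, last (w # ws)}"
    and w: "w \<noteq> u" "w \<noteq> last (w # ws)" and u: "u \<notin> set (w # ws)"
    and s: "s \<in> verts F" "h u s \<notin> X" and t: "t \<in> verts F" "h (last (w # ws)) t \<notin> X"
  shows "reach G' (dF + dB) (h u s) (h (last (w # ws)) t)"
proof -
  have ch': "charts_along G F \<pi> (w # ws) h" using ch by (auto simp: charts_along_def)
  have c: "fibre_chart G F \<pi> v (h v)" if "v \<in> set (u # w # ws)" for v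
    using ch that by (auto simp: charts_along_def)
  have no: "h v r \<notin> X" if "v \<in> set (w # ws)" "v \<noteq> last (w # ws)" "r \<in> verts F" for v r
    using clean[of "h v r"] chart_vertex[OF c[of v], of r] that u by fastforce
  have "{x \<in> X. \<pi> x = w} = {}" using clean w by auto
  then have "card {x \<in> X. \<pi> x = w} \<le> a" by (simp only: card.empty)
  then have row: "reach G' dF (h w s) (h w t)"
    using row_reach_few_faults[OF c[of w]] no[of w] s t w by simp
  have "{h u s, h w s} \<in> edges G" using ch s by (simp add: charts_along_def)
  moreover have "h u s \<in> verts G'" using chart_vertex[OF c[of u]] s by simp
  ultimately have "reach G' 1 (h u s) (h w s)"
    using reach_verts[OF row] by (auto intro!: reach_edge)
  moreover have "reach G' (length (w # ws) - 1) (h w t) (h (last (w # ws)) t)"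
    using column_reach[OF ch' _ t(1)] no t by fastforce
  ultimately have "reach G' (1 + dF + (length (w # ws) - 1)) (h u s) (h (last (w # ws)) t)"
    using row reach_trans by metis
  then show ?thesis by (rule reach_mono) (use len in simp)
qed

text \<open>The coordinates above which one cannot move along the whole path.\<close>

definition shadow :: "'b list \<Rightarrow> ('b \<Rightarrow> 'f \<Rightarrow> 'g) \<Rightarrow> 'f set" where
  "shadow ws h = {s \<in> verts F. \<exists>w \<in> set ws. h w s \<in> X}"

text \<open>Choose a fault above each coordinate of the shadow. A fault determines its base vertex and then
  its coordinate, so the choice is injective.\<close>

lemma card_shadow_le:
  assumes "charts_along G F \<pi> ws h"
  shows "card (shadow ws h) \<le> card {x \<in> X. \<pi> x \<in> set ws}"
proof -
  have c: "fibre_chart G F \<pi> w (h w)" if "w \<in> set ws" for w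
    using assms that by (auto simp: charts_along_def)
  have "\<forall>s \<in> shadow ws h. \<exists>w. w \<in> set ws \<and> h w s \<in> X" by (auto simp: shadow_def)
  then obtain W where W: "W s \<in> set ws" "h (W s) s \<in> X" if "s \<in> shadow ws h" for s
    by metis
  have base: "\<pi> (h (W s) s) = W s" if "s \<in> shadow ws h" for s
    using chart_vertex[OF c[OF W(1)[OF that]]] that by (simp add: shadow_def)
  show ?thesis
  proof (rule card_inj_on_le)
    show "inj_on (\<lambda>s. h (W s) s) (shadow ws h)"
    proof (rule inj_onI)
      fix s t assume st: "s \<in> shadow ws h" "t \<in> shadow ws h" and eq: "h (W s) s = h (W t) t"
      then have "W s = W t" using base by metis
      moreover have "inj_on (h (W s)) (verts F)"
        using c[OF W(1)[OF st(1)]] by (simp add: fibre_chart_def bij_betw_def)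
      ultimately show "s = t" using eq st by (auto simp: shadow_def dest: inj_onD)
    qed
    show "(\<lambda>s. h (W s) s) ` shadow ws h \<subseteq> {x \<in> X. \<pi> x \<in> set ws}" using W base by auto
  qed (use finX in simp)
qed

text \<open>If \<open>s \<noteq> t\<close>, a path from \<open>s\<close> to \<open>t\<close> with an inner vertex that avoids the at most \<open>a - 1\<close> other
  vertices of \<open>Z\<close> leaves \<open>Z\<close> with its first step and never returns to \<open>s\<close>. If \<open>s = t\<close>, any
  neighbour outside \<open>Z\<close> will do, and one step leads back.\<close>

lemma step_out_of_shadow:
  assumes Z: "Z \<subseteq> verts F" "card Z \<le> a + 1" and st: "s \<in> Z" "t \<in> Z"
  obtains r where "r \<in> verts F - Z" "{s, r} \<in> edges F" "reach (delete F (Z - {t}) {}) (dF - 1) r t"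
proof (cases "s = t")
  case True
  have fin: "finite Z" using Z resF by (auto simp: resilient_def intro: finite_subset)
  then have "card (Z - {s}) \<le> a" using Z st by simp
  then obtain r where r: "r \<in> verts F - (Z - {s})" "r \<noteq> s" "{s, r} \<in> edges F"
    by (rule resilient_neighbour[OF resF, of "Z - {s}" s, rotated]) (use fin Z st in auto)
  have "reach (delete F (Z - {t}) {}) 1 r t"
    using r True Z st by (auto intro!: reach_edge simp: insert_commute)
  then have "reach (delete F (Z - {t}) {}) (dF - 1) r t"
    by (rule reach_mono) (use resilient_bound_ge_2[OF resF] in simp)
  then show thesis using that r by blast
next
  case False
  have fin: "finite Z" using Z resF by (auto simp: resilient_def intro: finite_subset)
  have "card (Z - {s, t}) = card Z - 2" using fin st False by (simp add: card_Diff_subset)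
  moreover have "0 < a" using resF by (simp add: resilient_def)
  ultimately have "card (Z - {s, t}) < a" using Z by simp
  then obtain r zs where p: "is_path (delete F (Z - {s, t}) {}) s (s # r # zs) t"
    and len: "length (s # r # zs) \<le> Suc dF" and r: "r \<noteq> s" "r \<noteq> t"
    by (rule resilient_detour[OF resF, of "Z - {s, t}" s t, rotated]) (use Z st False in auto)
  have nd: "s \<notin> set (r # zs)" using p by (simp add: is_path_def)
  have succ: "successively (\<lambda>u v. {u, v} \<in> edges (delete F (Z - {s, t}) {})) (r # zs)"
    using p by (simp add: is_path_def)
  have "successively (\<lambda>u v. {u, v} \<in> edges (delete F (Z - {t}) {})) (r # zs)"
    by (rule successively_mono[OF succ]) (use nd in auto)
  then have "is_path (delete F (Z - {t}) {}) r (r # zs) t"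
    using p nd by (auto simp: is_path_def)
  then have "reach (delete F (Z - {t}) {}) (dF - 1) r t"
    by (rule path_reach) (use len in simp)
  moreover have "r \<in> verts F - Z" "{s, r} \<in> edges F" using p r by (auto simp: is_path_def)
  ultimately show thesis using that by blast
qed

text \<open>If the coordinate \<open>s\<close> is outside the shadow, the walk moves over the path first and then within
  the last fibre, provided that this fibre has at most \<open>a\<close> faults; symmetrically for \<open>t\<close> and the
  first fibre. A fibre with more than \<open>a\<close> faults contains all faults above the path, and then the
  healthy end in that fibre has its coordinate outside the shadow while the other fibre is free of
  faults. So one of the two orders works, unless both coordinates are in the shadow. In that case
  one step inside the first fibre leaves the shadow, the walk moves over the path, and it finishes
  in the last fibre, where \<open>t\<close> itself is healthy although it is in the shadow.\<close>

lemma reach_over_faulty_path: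
  assumes ch: "charts_along G F \<pi> ws h" and ws: "ws \<noteq> []" and ends: "hd ws \<noteq> last ws"
    and len: "length ws \<le> Suc dB"
    and few: "card {x \<in> X. \<pi> x \<in> set ws} \<le> a + 1"
    and s: "s \<in> verts F" "h (hd ws) s \<notin> X" and t: "t \<in> verts F" "h (last ws) t \<notin> X"
  shows "reach G' (dF + dB) (h (hd ws) s) (h (last ws) t)"
proof -
  let ?Z = "shadow ws h"
  have c: "fibre_chart G F \<pi> w (h w)" if "w \<in> set ws" for w
    using ch that by (auto simp: charts_along_def)
  have uv: "hd ws \<in> set ws" "last ws \<in> set ws" using ws by auto
  have col: "reach G' (length ws - 1) (h (hd ws) r) (h (last ws) r)" if "r \<in> verts F - ?Z" for r
    using column_reach[OF ch ws] that by (auto simp: shadow_def)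
  have finS: "finite {x \<in> X. \<pi> x \<in> set ws}" using finX by simp
  have crowded: "r \<notin> ?Z" "card {x \<in> X. \<pi> x = w'} \<le> a"
    if big: "\<not> card {x \<in> X. \<pi> x = w} \<le> a" and w: "w \<in> set ws" "w' \<in> set ws" "w' \<noteq> w"
      and r: "r \<in> verts F" "h w r \<notin> X" for w w' r
  proof -
    have all: "{x \<in> X. \<pi> x = w} = {x \<in> X. \<pi> x \<in> set ws}"
      by (rule card_seteq[OF finS]) (use w big few in auto)
    show "r \<notin> ?Z"
    proof
      assume "r \<in> ?Z"
      then obtain w'' where w'': "w'' \<in> set ws" "h w'' r \<in> X" by (auto simp: shadow_def)
      then have base: "\<pi> (h w'' r) = w''" using chart_vertex[OF c[OF w''(1)] r(1)] by simp
      then have "h w'' r \<in> {x \<in> X. \<pi> x \<in> set ws}" using w'' by simp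
      then have "w'' = w" using base unfolding all[symmetric] by simp
      then show False using w'' r by simp
    qed
    have "{x \<in> X. \<pi> x = w'} = {}" using all w by blast
    then show "card {x \<in> X. \<pi> x = w'} \<le> a" by (simp only: card.empty)
  qed
  consider (first) "s \<notin> ?Z" "card {x \<in> X. \<pi> x = last ws} \<le> a"
    | (last) "t \<notin> ?Z" "card {x \<in> X. \<pi> x = hd ws} \<le> a"
    | (both) "s \<in> ?Z" "t \<in> ?Z"
    using crowded[OF _ uv ends[symmetric] s] crowded[OF _ uv(2,1) ends t] by blast
  then show ?thesis
  proof cases
    case first
    then have "reach G' dF (h (last ws) s) (h (last ws) t)"
      using row_reach_few_faults[OF c[OF uv(2)]] s t uv by (auto simp: shadow_def)
    with col[of s] first s have "reach G' (length ws - 1 + dF) (h (hd ws) s) (h (last ws) t)"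
      using reach_trans by fastforce
    then show ?thesis by (rule reach_mono) (use len in simp)
  next
    case last
    then have "reach G' dF (h (hd ws) s) (h (hd ws) t)"
      using row_reach_few_faults[OF c[OF uv(1)]] s t uv by (auto simp: shadow_def)
    with col[of t] last t have "reach G' (dF + (length ws - 1)) (h (hd ws) s) (h (last ws) t)"
      using reach_trans by fastforce
    then show ?thesis by (rule reach_mono) (use len in simp)
  next
    case both
    have "?Z \<subseteq> verts F" by (auto simp: shadow_def)
    moreover have "card ?Z \<le> a + 1" using card_shadow_le[OF ch] few by simp
    ultimately obtain r where r: "r \<in> verts F - ?Z" "{s, r} \<in> edges F"
      and rt: "reach (delete F (?Z - {t}) {}) (dF - 1) r t"
      by (rule step_out_of_shadow[OF _ _ both])
    have "{h (hd ws) s, h (hd ws) r} \<in> edges G"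
      using c[OF uv(1)] r(2) by (simp add: fibre_chart_def)
    then have "reach G' 1 (h (hd ws) s) (h (hd ws) r)"
      using reach_verts[OF col[OF r(1)]] chart_vertex[OF c[OF uv(1)]] s
      by (auto intro!: reach_edge)
    moreover have "reach G' (dF - 1) (h (last ws) r) (h (last ws) t)"
      by (rule row_reach[OF c[OF uv(2)] rt]) (use uv t in \<open>auto simp: shadow_def\<close>)
    ultimately have "reach G' (1 + (length ws - 1) + (dF - 1)) (h (hd ws) s) (h (last ws) t)"
      using col[OF r(1)] reach_trans by metis
    then show ?thesis
      by (rule reach_mono) (use len resilient_bound_ge_2[OF resF] in simp)
  qed
qed

text \<open>The base vertices with faults above them, apart from the two ends, are avoided completely when
  they are fewer than \<open>b\<close>; otherwise avoiding \<open>b\<close> of them leaves at most \<open>a + 1\<close> faults.\<close>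

lemma reach_different_fibres:
  assumes x: "x \<in> verts G'" and y: "y \<in> verts G'" and neq: "\<pi> x \<noteq> \<pi> y"
  shows "reach G' (dF + dB) x y"
proof -
  let ?Q = "\<pi> ` X \<inter> verts B - {\<pi> x, \<pi> y}"
  have finQ: "finite ?Q" using finX by simp
  have uv: "\<pi> x \<in> verts B" "\<pi> y \<in> verts B"
    using x y proj by (auto simp: fibre_projection_def)
  show ?thesis
  proof (cases "card ?Q < b")
    case True
    then obtain w zs where p: "is_path (delete B ?Q {}) (\<pi> x) (\<pi> x # w # zs) (\<pi> y)"
      and len: "length (\<pi> x # w # zs) \<le> Suc dB" and w: "w \<noteq> \<pi> x" "w \<noteq> \<pi> y"
      by (rule resilient_detour[OF resB, of ?Q "\<pi> x" "\<pi> y", rotated]) (use uv neq in auto)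
    obtain h where ch: "charts_along G F \<pi> (\<pi> x # w # zs) h" using charts_along_base_path[OF p] .
    have l: "last (w # zs) = \<pi> y" using p by (simp add: is_path_def)
    then have "\<pi> y \<in> set (w # zs)" by (metis last_in_set list.discI)
    then have c: "fibre_chart G F \<pi> (\<pi> x) (h (\<pi> x))" "fibre_chart G F \<pi> (\<pi> y) (h (\<pi> y))"
      using ch by (auto simp: charts_along_def)
    obtain s where s: "s \<in> verts F" "h (\<pi> x) s = x" using coordinate[OF c(1)] x by auto
    obtain t where t: "t \<in> verts F" "h (\<pi> y) t = y" using coordinate[OF c(2)] y by auto
    have "reach G' (dF + dB) (h (\<pi> x) s) (h (last (w # zs)) t)"
      by (rule reach_via_clean_fibre[OF ch len]) (use p w l s t x y in \<open>auto simp: is_path_def\<close>)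
    then show ?thesis using s t l by simp
  next
    case False
    then obtain Q where Q: "Q \<subseteq> ?Q" "card Q = b"
      using obtain_subset_with_card_n[of b ?Q] by auto
    have finQ': "finite Q" using finite_subset[OF Q(1) finQ] .
    obtain ws where p: "is_path (delete B Q {}) (\<pi> x) ws (\<pi> y)" and len: "length ws \<le> Suc dB"
      by (rule resilient_path[OF resB finQ', of "\<pi> x" "\<pi> y"]) (use Q uv in auto)
    obtain h where ch: "charts_along G F \<pi> ws h" using charts_along_base_path[OF p] .
    have ws: "ws \<noteq> []" "hd ws = \<pi> x" "last ws = \<pi> y"
      using p by (auto simp: is_path_def)
    then have "\<pi> x \<in> set ws" "\<pi> y \<in> set ws" by (metis hd_in_set last_in_set)+
    then have c: "fibre_chart G F \<pi> (\<pi> x) (h (\<pi> x))" "fibre_chart G F \<pi> (\<pi> y) (h (\<pi> y))"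
      using ch by (auto simp: charts_along_def)
    obtain s where s: "s \<in> verts F" "h (\<pi> x) s = x" using coordinate[OF c(1)] x by auto
    obtain t where t: "t \<in> verts F" "h (\<pi> y) t = y" using coordinate[OF c(2)] y by auto
    have "b \<le> card {x \<in> X. \<pi> x \<in> Q}"
      using surj_card_le[of "{x \<in> X. \<pi> x \<in> Q}" Q \<pi>] Q finX by auto
    moreover have "card X = card {x \<in> X. \<pi> x \<in> Q} + card {x \<in> X. \<pi> x \<notin> Q}"
      using finX by (subst card_Un_disjoint[symmetric]) (auto intro!: arg_cong[of _ _ card])
    moreover have "card {x \<in> X. \<pi> x \<in> set ws} \<le> card {x \<in> X. \<pi> x \<notin> Q}"
      by (rule card_mono) (use p finX in \<open>auto simp: is_path_def\<close>)
    ultimately have few: "card {x \<in> X. \<pi> x \<in> set ws} \<le> a + 1" using cardX by simp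
    have "reach G' (dF + dB) (h (hd ws) s) (h (last ws) t)"
      by (rule reach_over_faulty_path[OF ch ws(1) _ len few])
        (use s t x y ws neq in auto)
    then show ?thesis using s t ws by simp
  qed
qed

lemma reach_after_faults: "\<lbrakk>x \<in> verts G'; y \<in> verts G'\<rbrakk> \<Longrightarrow> reach G' (dF + dB) x y"
  using reach_same_fibre reach_different_fibres by blast

end

section \<open>The fault diameter of the bundle\<close>

lemma card_verts_bundle:
  assumes "fibre_projection G F B \<pi>" "finite (verts G)" "finite (verts B)"
  shows "card (verts G) = card (verts B) * card (verts F)"
proof -
  have "card (\<Union>v \<in> verts B. {x \<in> verts G. \<pi> x = v}) = (\<Sum>v \<in> verts B. card {x \<in> verts G. \<pi> x = v})"
    by (rule card_UN_disjoint) (use assms in auto)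
  also have "\<dots> = (\<Sum>v \<in> verts B. card (verts F))"
  proof (rule sum.cong[OF refl])
    fix v assume "v \<in> verts B"
    then obtain h where "fibre_chart G F \<pi> v h" using assms(1) by (auto simp: fibre_projection_def)
    then have "bij_betw h (verts F) {x \<in> verts G. \<pi> x = v}" by (simp add: fibre_chart_def)
    from bij_betw_same_card[OF this]
    show "card {x \<in> verts G. \<pi> x = v} = card (verts F)" by simp
  qed
  also have "(\<Union>v \<in> verts B. {x \<in> verts G. \<pi> x = v}) = verts G"
    using assms(1) by (auto simp: fibre_projection_def)
  finally show ?thesis by simp
qed

text \<open>Short walks after every set of at most \<open>c\<close> faults also show that \<open>c\<close> is less than the
  connectivity, so that the fault diameter is not \<open>\<infinity>\<close> by default.\<close>

lemma vertex_fault_diameter_leI: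
  assumes fin: "finite (verts G)" and card: "c + 2 \<le> card (verts G)"
    and r: "\<And>X x y. \<lbrakk>X \<subseteq> verts G; card X \<le> c; x \<in> verts G - X; y \<in> verts G - X\<rbrakk>
              \<Longrightarrow> reach (delete G X {}) d x y"
  shows "vertex_fault_diameter c G \<le> enat d"
proof -
  have two: "2 \<le> card (verts (delete G X {}))" if "X \<subseteq> verts G" "card X \<le> c" for X
    using that fin card by (simp add: card_Diff_subset finite_subset)
  have "c < connectivity G"
  proof (cases "complete_graph G")
    case True
    then show ?thesis using card by (simp add: connectivity_def)
  next
    case False
    let ?P = "\<lambda>c. \<exists>X \<subseteq> verts G. card X = c \<and> \<not> connected_graph (delete G X {})"
    have "\<not> connected_graph (delete G (verts G) {})" by (simp add: connected_graph_def)
    then have "?P (card (verts G))" by blast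
    then have "?P (LEAST c. ?P c)" by (rule LeastI)
    moreover have "\<not> ?P m" if "m \<le> c" for m
      using connected_if_reach[OF two r] that by auto
    ultimately have "\<not> (LEAST c. ?P c) \<le> c" by blast
    then show ?thesis using False by (simp add: connectivity_def)
  qed
  moreover have "diameter (delete G X {}) \<le> enat d" if "X \<subseteq> verts G" "card X = c" for X
    by (rule diameter_le_if_reach[OF two r]) (use that in auto)
  ultimately show ?thesis by (auto simp: vertex_fault_diameter_def intro!: Sup_least)
qed

theorem theorem5p1:
  fixes F :: "'f sgraph" and B :: "'b sgraph" and G :: "'g sgraph"
    and kF kB a b :: nat
  assumes "simple_graph F" and "simple_graph B" and "simple_graph G"
    and "k_connected kF F" and "k_connected kB B"
    and "cartesian_bundle G F B"
    and "0 < a" and "a < kF"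
    and "0 < b" and "b < kB"
    and "mixed_fault_diameter (a - 1) 1 F \<le> vertex_fault_diameter a F"
    and "mixed_fault_diameter (b - 1) 1 B \<le> vertex_fault_diameter b B"
  shows "vertex_fault_diameter (a + b + 1) G
           \<le> vertex_fault_diameter a F + vertex_fault_diameter b B"
proof -
  have fin: "finite (verts F)" "finite (verts B)" "finite (verts G)"
    using assms(1-3) by (auto simp: simple_graph_def)
  have less: "a < connectivity F" "b < connectivity B"
    using assms by (auto simp: k_connected_def)
  obtain dF where dF: "vertex_fault_diameter a F = enat dF"
    using vertex_fault_diameter_finite[OF fin(1) less(1)] .
  obtain dB where dB: "vertex_fault_diameter b B = enat dB"
    using vertex_fault_diameter_finite[OF fin(2) less(2)] .
  have resF: "resilient F a dF" by (rule resilientI) (use fin less dF assms in auto)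
  have resB: "resilient B b dB" by (rule resilientI) (use fin less dB assms in auto)
  obtain \<pi> where proj: "fibre_projection G F B \<pi>"
    using fibre_projection_if_bundle[OF assms(1,2,6)] .
  have "(b + 2) * (a + 2) \<le> card (verts G)"
    unfolding card_verts_bundle[OF proj fin(3,2)]
    using resF resB by (intro mult_le_mono) (auto simp: resilient_def)
  then have card: "a + b + 1 + 2 \<le> card (verts G)" by (simp add: algebra_simps)
  have "vertex_fault_diameter (a + b + 1) G \<le> enat (dF + dB)"
  proof (rule vertex_fault_diameter_leI[OF fin(3) card])
    fix X x y
    assume X: "X \<subseteq> verts G" "card X \<le> a + b + 1" and xy: "x \<in> verts G - X" "y \<in> verts G - X"
    interpret faulty_bundle G F B \<pi> a b dF dB X
      by unfold_locales (use assms resF resB proj X fin finite_subset in auto)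
    show "reach (delete G X {}) (dF + dB) x y" using reach_after_faults xy by simp
  qed
  then show ?thesis by (simp add: dF dB)
qed

end
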